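(* Let $m,n\ge1$ be integers and let the knots satisfy $$t_{-m}=t_{-m+1}=\dots=t_0\le t_1\le\dots\le t_{n-1}\le t_n=t_{n+1}=\dots=t_{n+m},\qquad t_0<t_n,$$ where no inner knot $t_1,\dots,t_{n-1}$ has multiplicity greater than $m$ in the sequence $(t_{-m},\dots,t_{n+m})$. Let $n_e$ be the number of indices $j\in\{0,1,\dots,n-1\}$ for which the knot span $[t_j,t_{j+1})$ is non-empty. Then all $n_e(m+1)^2$ adjusted Bernstein–Bézier coefficients $b_k^{(i,j)}$ of the B-spline functions $N_{mi}$ over the non-empty knot spans $[t_j,t_{j+1})$, for $0\le j\le n-1$, $i=j-m,j-m+1,\dots,j$ and $k=0,1,\dots,m$, can be computed in $O(n_e m^2)$ time.
   Context: B-spline functions: for knots $t_i\le t_{i+1}\le\dots\le t_{i+m+1}$, the B-spline (basis) function of degree $m$ is $N_{mi}(u)=(t_{i+m+1}-t_i)\,[t_i,t_{i+1},\dots,t_{i+m+1}](t-u)_+^m$, where the generalized (confluent) divided difference acts on the variable $t$, and $(x-c)_+^m=(x-c)^m$ if $x\ge c$ and $0$ if $x<c$. On $[t_0,t_n)$ the functions are given (with values at the knots taken right-continuously) by the de Boor–Mansfield–Cox recursion: for $i=0,\dots,n-1$, $N_{0i}(u)=1$ if $u\in[t_i,t_{i+1})$ and $N_{0i}(u)=0$ otherwise, and for $p\ge1$, $-p\le i<n$, $$N_{pi}(u)=(u-t_i)\frac{N_{p-1,i}(u)}{t_{p+i}-t_i}+(t_{p+i+1}-u)\frac{N_{p-1,i+1}(u)}{t_{p+i+1}-t_{i+1}},$$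 with the conventions that any quotient with zero denominator is $0$ and that $N_{pi}\equiv0$ for $i<-p$ or $i\ge n$. Bernstein polynomials: $B_k^m(t)=\binom{m}{k}t^k(1-t)^{m-k}$, $0\le k\le m$. Adjusted Bernstein–Bézier coefficients: on a non-empty knot span $[t_j,t_{j+1})$ $(0\le j\le n-1)$ each $N_{mi}$ is a polynomial of degree at most $m$, and the numbers $b_k^{(i,j)}$ $(0\le k\le m)$ are defined by $$N_{mi}(u)=\sum_{k=0}^m b_k^{(i,j)}B_k^m\Big(\frac{u-t_j}{t_{j+1}-t_j}\Big)\qquad(t_j\le u<t_{j+1}).$$ Time counts real arithmetic operations, the input being $n$, $m$ and the knots. *)

theory Defs
  imports "HOL-Analysis.Analysis"
begin

section \<open>Real random access machine\<close>

text \<open>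
  Programs act on integer variables, which serve for addressing and control only, and on
  arrays of real numbers indexed by tuples of integers. The time of a computation is the number of
  operations on real numbers (additions, subtractions, multiplications, divisions, and also
  comparisons) that it executes; copying a real number and arithmetic on integer variables are not
  counted. The two kinds of data are strictly separated: integer variables cannot be converted to
  real numbers and the only literals are integers, so every other real value has to be obtained
  from the input by counted operations.
\<close>

type_synonym vname = string
type_synonym state = "(vname \<Rightarrow> int) \<times> (vname \<Rightarrow> int list \<Rightarrow> real)"

datatype iexp =
    IConst int
  | IVar vname
  | IAdd iexp iexp
  | ISub iexp iexp
  | IMul iexp iexp

datatype rexp =
    RConst int
  | RRead vname "iexp list"
  | RAdd rexp rexp
  | RSub rexp rexp
  | RMul rexp rexp
  | RDiv rexp rexp

datatype bexp =
    ILess iexp iexp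
  | RLess rexp rexp
  | BNot bexp
  | BAnd bexp bexp

datatype com =
    Skip
  | IAssign vname iexp
  | RAssign vname "iexp list" rexp
  | Seq com com
  | Cond bexp com com
  | While bexp com

primrec ival :: "iexp \<Rightarrow> state \<Rightarrow> int" where
  "ival (IConst c) s = c"
| "ival (IVar x) s = fst s x"
| "ival (IAdd a b) s = ival a s + ival b s"
| "ival (ISub a b) s = ival a s - ival b s"
| "ival (IMul a b) s = ival a s * ival b s"

text \<open>
  A division by zero yields zero; a program could arrange this itself at the price of one
  comparison.
\<close>

primrec rval :: "rexp \<Rightarrow> state \<Rightarrow> real" where
  "rval (RConst c) s = of_int c"
| "rval (RRead x as) s = snd s x (map (\<lambda>a. ival a s) as)"
| "rval (RAdd a b) s = rval a s + rval b s"
| "rval (RSub a b) s = rval a s - rval b s"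
| "rval (RMul a b) s = rval a s * rval b s"
| "rval (RDiv a b) s = rval a s / rval b s"

primrec rtime :: "rexp \<Rightarrow> nat" where
  "rtime (RConst c) = 0"
| "rtime (RRead x as) = 0"
| "rtime (RAdd a b) = rtime a + rtime b + 1"
| "rtime (RSub a b) = rtime a + rtime b + 1"
| "rtime (RMul a b) = rtime a + rtime b + 1"
| "rtime (RDiv a b) = rtime a + rtime b + 1"

primrec bval :: "bexp \<Rightarrow> state \<Rightarrow> bool" where
  "bval (ILess a b) s = (ival a s < ival b s)"
| "bval (RLess a b) s = (rval a s < rval b s)"
| "bval (BNot b) s = (\<not> bval b s)"
| "bval (BAnd b c) s = (bval b s \<and> bval c s)"

primrec btime :: "bexp \<Rightarrow> nat" where
  "btime (ILess a b) = 0"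
| "btime (RLess a b) = rtime a + rtime b + 1"
| "btime (BNot b) = btime b"
| "btime (BAnd b c) = btime b + btime c"

definition iupdate :: "state \<Rightarrow> vname \<Rightarrow> int \<Rightarrow> state" where
  "iupdate s x v = ((fst s)(x := v), snd s)"

definition rupdate :: "state \<Rightarrow> vname \<Rightarrow> int list \<Rightarrow> real \<Rightarrow> state" where
  "rupdate s x is v = (fst s, (snd s)(x := (snd s x)(is := v)))"

text \<open>\<open>exec c s T s'\<close>: started in \<open>s\<close>, the program \<open>c\<close> terminates in \<open>s'\<close> after time \<open>T\<close>.\<close>

inductive exec :: "com \<Rightarrow> state \<Rightarrow> nat \<Rightarrow> state \<Rightarrow> bool" where
  Skip: "exec Skip s 0 s"
| IAssign: "exec (IAssign x a) s 0 (iupdate s x (ival a s))"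
| RAssign: "exec (RAssign x as e) s (rtime e) (rupdate s x (map (\<lambda>a. ival a s) as) (rval e s))"
| Seq: "exec c s T s' \<Longrightarrow> exec d s' U s'' \<Longrightarrow> exec (Seq c d) s (T + U) s''"
| CondTrue: "bval b s \<Longrightarrow> exec c s T s' \<Longrightarrow> exec (Cond b c d) s (btime b + T) s'"
| CondFalse: "\<not> bval b s \<Longrightarrow> exec d s T s' \<Longrightarrow> exec (Cond b c d) s (btime b + T) s'"
| WhileTrue: "bval b s \<Longrightarrow> exec c s T s' \<Longrightarrow> exec (While b c) s' U s''
    \<Longrightarrow> exec (While b c) s (btime b + T + U) s''"
| WhileFalse: "\<not> bval b s \<Longrightarrow> exec (While b c) s (btime b) s"

inductive_cases exec_SkipE: "exec Skip s T s'"
  and exec_IAssignE: "exec (IAssign x a) s T s'"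
  and exec_RAssignE: "exec (RAssign x as e) s T s'"
  and exec_SeqE: "exec (Seq c d) s T s'"
  and exec_CondE: "exec (Cond b c d) s T s'"
  and exec_WhileE: "exec (While b c) s T s'"

lemma exec_deterministic:
  "exec c s T s' \<Longrightarrow> exec c s T' s'' \<Longrightarrow> T = T' \<and> s' = s''"
proof (induction arbitrary: T' s'' rule: exec.induct)
  case (Seq c s T s' d U s2)
  then show ?case by (metis exec_SeqE)
next
  case (CondTrue b s c T s' d)
  then show ?case by (metis exec_CondE)
next
  case (CondFalse b s d T s' c)
  then show ?case by (metis exec_CondE)
next
  case (WhileTrue b s c T s' U s2)
  from WhileTrue.prems WhileTrue.hyps(1) obtain T1 s1 U1 where
    "T' = btime b + T1 + U1" "exec c s T1 s1" "exec (While b c) s1 U1 s''"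
    by (auto elim: exec_WhileE)
  with WhileTrue.IH show ?case by blast
next
  case (WhileFalse b s c)
  then show ?case by (auto elim: exec_WhileE)
qed (auto elim: exec_SkipE exec_IAssignE exec_RAssignE)


section \<open>Knots and B-spline functions\<close>

text \<open>
  Only the values of \<open>t\<close> on \<open>{- m..n + m}\<close> are relevant.
\<close>

definition knot_multiplicity :: "nat \<Rightarrow> nat \<Rightarrow> (int \<Rightarrow> real) \<Rightarrow> int \<Rightarrow> nat" where
  "knot_multiplicity m n t r = card {l \<in> {- int m..int n + int m}. t l = t r}"

definition admissible_knots :: "nat \<Rightarrow> nat \<Rightarrow> (int \<Rightarrow> real) \<Rightarrow> bool" where
  "admissible_knots m n t \<longleftrightarrow>
     (\<forall>l \<in> {- int m..0}. t l = t 0) \<and>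
     (\<forall>l \<in> {0..<int n}. t l \<le> t (l + 1)) \<and>
     (\<forall>l \<in> {int n..int n + int m}. t l = t (int n)) \<and>
     t 0 < t (int n) \<and>
     (\<forall>r \<in> {1..int n - 1}. knot_multiplicity m n t r \<le> m)"

definition nonempty_spans :: "nat \<Rightarrow> (int \<Rightarrow> real) \<Rightarrow> int set" where
  "nonempty_spans n t = {j \<in> {0..int n - 1}. {t j..<t (j + 1)} \<noteq> {}}"

text \<open>
  The de Boor--Mansfield--Cox recursion on \<open>[t\<^sub>0, t\<^sub>n)\<close>; the convention that quotients with
  zero denominator vanish is that of \<^term>\<open>(/) :: real \<Rightarrow> real \<Rightarrow> real\<close>.
\<close>

fun bspline :: "nat \<Rightarrow> (int \<Rightarrow> real) \<Rightarrow> nat \<Rightarrow> int \<Rightarrow> real \<Rightarrow> real" where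
  "bspline n t 0 i u =
     (if 0 \<le> i \<and> i < int n \<and> u \<in> {t i..<t (i + 1)} then 1 else 0)"
| "bspline n t (Suc q) i u =
     (let p = int (Suc q) in
      if - p \<le> i \<and> i < int n
      then (u - t i) * (bspline n t q i u / (t (p + i) - t i))
         + (t (p + i + 1) - u) * (bspline n t q (i + 1) u / (t (p + i + 1) - t (i + 1)))
      else 0)"

text \<open>
  \<open>b 0, \<dots>, b m\<close> are the adjusted Bernstein--Bezier coefficients of the \<open>i\<close>-th B-spline function
  of degree \<open>m\<close> over the (non-empty) knot span \<open>[t\<^sub>j, t\<^sub>j\<^sub>+\<^sub>1)\<close>.
\<close>

definition adjusted_BB_coeffs ::
  "nat \<Rightarrow> nat \<Rightarrow> (int \<Rightarrow> real) \<Rightarrow> int \<Rightarrow> int \<Rightarrow> (nat \<Rightarrow> real) \<Rightarrow> bool" where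
  "adjusted_BB_coeffs m n t i j b \<longleftrightarrow>
     (\<forall>u \<in> {t j..<t (j + 1)}.
        bspline n t m i u = (\<Sum>k\<le>m. b k * Bernstein m k ((u - t j) / (t (j + 1) - t j))))"


section \<open>Input and output\<close>

text \<open>Everything except \<open>m\<close>, \<open>n\<close> and the knots \<open>t\<^sub>-\<^sub>m, \<dots>, t\<^sub>n\<^sub>+\<^sub>m\<close> is initialised with zero.\<close>

definition input_state :: "nat \<Rightarrow> nat \<Rightarrow> (int \<Rightarrow> real) \<Rightarrow> state" where
  "input_state m n t =
     ((\<lambda>_. 0)(''m'' := int m, ''n'' := int n),
      (\<lambda>_ _. 0)(''t'' := (\<lambda>is. case is of
           [l] \<Rightarrow> if l \<in> {- int m..int n + int m} then t l else 0
         | _ \<Rightarrow> 0)))"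

text \<open>The coefficient \<open>b_k^(i,j)\<close> is expected in the array \<open>b\<close> at the index \<open>(i, j, k)\<close>.\<close>

definition output_coeff :: "state \<Rightarrow> int \<Rightarrow> int \<Rightarrow> nat \<Rightarrow> real" where
  "output_coeff s i j k = snd s ''b'' [i, j, int k]"

end

theory Submission
  imports Defs
begin

text \<open>
  On a non-empty span \<open>[t\<^sub>j, t\<^sub>j\<^sub>+\<^sub>1)\<close> each B-spline function is a polynomial, and its \<open>k\<close>-th
  Bernstein--Bezier coefficient is the value of its blossom (polar form) with \<open>m - k\<close> arguments
  \<open>t\<^sub>j\<close> and \<open>k\<close> arguments \<open>t\<^sub>j\<^sub>+\<^sub>1\<close>. The blossoms satisfy the same recursion in the degree as the
  functions, except that the variable \<open>u\<close> is replaced by any one of the arguments. Because the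
  blossom is symmetric, a degree can be stripped off through an argument \<open>t\<^sub>j\<^sub>+\<^sub>1\<close> (by definition
  of \<open>bb_coeff\<close>) as well as through an argument \<open>t\<^sub>j\<close> (lemma \<open>bb_coeff_remove_left\<close>).

  Descending through all degrees would cost \<open>m\<^sup>3\<close> operations per span. Instead, the two ways of
  stripping an argument express the neighbouring coefficients \<open>k\<close> and \<open>k + 1\<close> of \<open>N\<^sub>m\<^sub>i\<close> linearly
  through the same two coefficients of degree \<open>m - 1\<close>, which belong to \<open>i\<close> and \<open>i + 1\<close>. The one
  belonging to \<open>i + 1\<close> can therefore be computed from the coefficients of \<open>N\<^sub>m\<^sub>i\<close>, and likewise
  from those of \<open>N\<^sub>m\<^sub>,\<^sub>i\<^sub>+\<^sub>1\<close>. Equating both expressions eliminates the lower degree and yields a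
  relation between four coefficients of degree \<open>m\<close>, namely \<open>k, k + 1\<close> for \<open>i, i + 1\<close>
  (lemma \<open>bb_coeff_sweep\<close>). It gives each coefficient in a constant number of operations, for
  \<open>i = j, j - 1, \<dots>\<close> and \<open>k = m - 1, m - 2, \<dots>\<close>. The starting values \<open>k = m\<close> are the limits of the
  \<open>N\<^sub>m\<^sub>i\<close> at the right end of the span; the triangular de Boor--Mansfield--Cox scheme computes
  them for all \<open>i\<close> at once in \<open>O(m\<^sup>2)\<close> operations.

  Finding the non-empty spans takes one comparison for each of the \<open>n\<close> spans. As no inner knot
  has a multiplicity above \<open>m\<close>, a non-empty span is followed by at most \<open>m - 1\<close> empty ones, so that
  \<open>n \<le> n\<^sub>e m\<close> (lemma \<open>length_le_nonempty_spans\<close>).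
\<close>

section \<open>Coefficients as blossom values\<close>

text \<open>
  The blossom of the \<open>i\<close>-th B-spline function of degree \<open>p\<close> over \<open>[t\<^sub>j, t\<^sub>j\<^sub>+\<^sub>1)\<close> at \<open>p - k\<close> copies of
  \<open>t\<^sub>j\<close> and \<open>k\<close> copies of \<open>t\<^sub>j\<^sub>+\<^sub>1\<close>. Preferring to consume the argument \<open>t\<^sub>j\<^sub>+\<^sub>1\<close> makes the recursion
  deterministic; the values for \<open>k > p\<close> have no meaning.
\<close>

fun bb_coeff :: "(int \<Rightarrow> real) \<Rightarrow> int \<Rightarrow> nat \<Rightarrow> int \<Rightarrow> nat \<Rightarrow> real" where
  "bb_coeff t j 0 i k = (if i = j then 1 else 0)"
| "bb_coeff t j (Suc p) i 0 =
     (t j - t i) * (bb_coeff t j p i 0 / (t (i + int p + 1) - t i))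
   + (t (i + int p + 2) - t j) * (bb_coeff t j p (i + 1) 0 / (t (i + int p + 2) - t (i + 1)))"
| "bb_coeff t j (Suc p) i (Suc k) =
     (t (j + 1) - t i) * (bb_coeff t j p i k / (t (i + int p + 1) - t i))
   + (t (i + int p + 2) - t (j + 1)) * (bb_coeff t j p (i + 1) k / (t (i + int p + 2) - t (i + 1)))"

declare bb_coeff.simps(2,3) [simp del]

lemma bb_coeff_eq_0: "j < i \<or> i < j - int p \<Longrightarrow> bb_coeff t j p i k = 0"
proof (induction p arbitrary: i k)
  case 0
  then show ?case by auto
next
  case (Suc p)
  then have "bb_coeff t j p i k' = 0" "bb_coeff t j p (i + 1) k' = 0" for k' by auto
  then show ?case by (cases k) (simp_all add: bb_coeff.simps(2,3))
qed

text \<open>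
  The symmetry of the blossom in two arguments \<open>x\<close> and \<open>y\<close> that are consumed by consecutive steps
  of the recursion, where \<open>A0, A1, A2\<close> stand for the weighted values two degrees below. The terms
  with \<open>A0\<close> and \<open>A2\<close> are visibly symmetric. In the factor of \<open>A1\<close>, the two summands change by
  \<open>y - x\<close> and \<open>x - y\<close> when \<open>x\<close> and \<open>y\<close> are exchanged, provided that no denominator vanishes.
\<close>

lemma two_steps_commute:
  fixes a b c d x y A0 A1 A2 :: real
  assumes "A1 \<noteq> 0 \<Longrightarrow> a < c \<and> b < d"
  shows "(y - a) * (((x - a) * A0 + (c - x) * A1) / (c - a))
       + (d - y) * (((x - b) * A1 + (d - x) * A2) / (d - b))
       = (x - a) * (((y - a) * A0 + (c - y) * A1) / (c - a))
       + (d - x) * (((y - b) * A1 + (d - y) * A2) / (d - b))"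
proof (cases "A1 = 0")
  case True
  then show ?thesis by (simp add: algebra_simps)
next
  case False
  with assms have "c - a \<noteq> 0" "d - b \<noteq> 0" by auto
  then show ?thesis by (simp add: divide_simps) (simp add: algebra_simps)
qed

text \<open>One step of de Casteljau's algorithm, from \<open>B\<^sub>k\<^sup>p\<^sup>+\<^sup>1 = (1 - x) B\<^sub>k\<^sup>p + x B\<^sub>k\<^sub>-\<^sub>1\<^sup>p\<close>.\<close>

lemma Bernstein_Suc_sum:
  fixes c :: "nat \<Rightarrow> real"
  shows "(\<Sum>k\<le>Suc p. c k * Bernstein (Suc p) k x)
       = (\<Sum>k\<le>p. ((1 - x) * c k + x * c (Suc k)) * Bernstein p k x)"
proof -
  have B0: "Bernstein (Suc p) 0 x = (1 - x) * Bernstein p 0 x"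
    by (simp add: Bernstein_def)
  have BS: "Bernstein (Suc p) (Suc k) x = x * Bernstein p k x + (1 - x) * Bernstein p (Suc k) x"
    if "k \<le> p" for k
  proof (cases "k = p")
    case True
    then show ?thesis by (simp add: Bernstein_def)
  next
    case False
    then have "p - k = Suc (p - Suc k)" using that by simp
    then show ?thesis by (simp add: Bernstein_def algebra_simps)
  qed
  have B1: "Bernstein p (Suc p) x = 0"
    by (simp add: Bernstein_def)
  have "(\<Sum>k\<le>Suc p. c k * Bernstein (Suc p) k x)
      = c 0 * Bernstein (Suc p) 0 x + (\<Sum>k\<le>p. c (Suc k) * Bernstein (Suc p) (Suc k) x)"
    by (rule sum.atMost_Suc_shift)
  also have "\<dots> = (\<Sum>k\<le>p. x * c (Suc k) * Bernstein p k x)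
      + (1 - x) * (c 0 * Bernstein p 0 x + (\<Sum>k\<le>p. c (Suc k) * Bernstein p (Suc k) x))"
  proof -
    have "(\<Sum>k\<le>p. c (Suc k) * Bernstein (Suc p) (Suc k) x)
        = (\<Sum>k\<le>p. x * c (Suc k) * Bernstein p k x + (1 - x) * (c (Suc k) * Bernstein p (Suc k) x))"
      by (rule sum.cong) (simp_all add: BS distrib_left mult_ac)
    then show ?thesis
      by (simp add: B0 sum.distrib sum_distrib_left distrib_left mult_ac)
  qed
  also have "c 0 * Bernstein p 0 x + (\<Sum>k\<le>p. c (Suc k) * Bernstein p (Suc k) x)
      = (\<Sum>k\<le>Suc p. c k * Bernstein p k x)"
    by (rule sum.atMost_Suc_shift [symmetric])
  also have "\<dots> = (\<Sum>k\<le>p. c k * Bernstein p k x)"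
    by (simp add: B1)
  finally show ?thesis
    unfolding sum_distrib_left sum.distrib [symmetric]
    by (simp add: algebra_simps)
qed

locale knot_span =
  fixes m n :: nat and t :: "int \<Rightarrow> real" and j :: int
  assumes mono: "\<And>k l. - int m \<le> k \<Longrightarrow> k \<le> l \<Longrightarrow> l \<le> int n + int m \<Longrightarrow> t k \<le> t l"
    and j_range: "0 \<le> j" "j < int n"
    and nonempty: "t j < t (j + 1)"
begin

lemma support_knots:
  assumes "l \<le> j" "j < r" "- int m \<le> l" "r \<le> int n + int m"
  shows "t l < t r"
proof -
  have "t l \<le> t j" "t (j + 1) \<le> t r"
    using assms j_range by (auto intro!: mono)
  with nonempty show ?thesis by linarith
qed

text \<open>
  The recursion may equally consume an argument \<open>t\<^sub>j\<close>. In the induction step the definition consumes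
  \<open>t\<^sub>j\<^sub>+\<^sub>1\<close> and the induction hypothesis then \<open>t\<^sub>j\<close>; exchanging the two steps gives the claim. A
  middle value that does not vanish belongs to a B-spline function whose support contains the span,
  and this keeps the denominators away from zero.
\<close>

lemma bb_coeff_remove_left:
  assumes "p < m" "k \<le> p"
  shows "bb_coeff t j (Suc p) i k =
      (t j - t i) * (bb_coeff t j p i k / (t (i + int p + 1) - t i))
    + (t (i + int p + 2) - t j) * (bb_coeff t j p (i + 1) k / (t (i + int p + 2) - t (i + 1)))"
  using assms
proof (induction p arbitrary: i k)
  case 0
  then show ?case by (simp add: bb_coeff.simps(2))
next
  case (Suc p)
  show ?case
  proof (cases k)
    case 0
    then show ?thesis by (simp only: bb_coeff.simps(2))
  next
    case (Suc k')
    define A where "A l = bb_coeff t j p l k' / (t (l + int p + 1) - t l)" for l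
    have L: "bb_coeff t j (Suc p) l k'
        = (t j - t l) * A l + (t (l + int p + 2) - t j) * A (l + 1)" for l
      using Suc.IH[of k' l] Suc.prems Suc by (simp add: A_def algebra_simps)
    have R: "bb_coeff t j (Suc p) l (Suc k')
        = (t (j + 1) - t l) * A l + (t (l + int p + 2) - t (j + 1)) * A (l + 1)" for l
      by (simp add: bb_coeff.simps(3) A_def algebra_simps)
    have nz: "t i < t (i + int p + 2) \<and> t (i + 1) < t (i + int p + 3)" if "A (i + 1) \<noteq> 0"
    proof -
      have "bb_coeff t j p (i + 1) k' \<noteq> 0" using that by (auto simp: A_def)
      then have "i + 1 \<le> j" "j \<le> i + 1 + int p"
        using bb_coeff_eq_0[of j "i + 1" p t k'] by linarith+
      with Suc.prems j_range show ?thesis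
        by (auto intro!: support_knots)
    qed
    from two_steps_commute[of "A (i + 1)" "t i" "t (i + int p + 2)" "t (i + 1)"
        "t (i + int p + 3)" "t (j + 1)" "t j" "A i" "A (i + 2)", OF nz]
    show ?thesis
      unfolding Suc bb_coeff.simps(3)[of t j "Suc p"] L R by (simp add: algebra_simps)
  qed
qed

text \<open>
  For \<open>u = (1 - x) t\<^sub>j + x t\<^sub>j\<^sub>+\<^sub>1\<close>, the recursion for \<open>N\<^sub>p\<^sub>i(u)\<close> is the convex combination of the two
  recursions that consume \<open>t\<^sub>j\<close> and \<open>t\<^sub>j\<^sub>+\<^sub>1\<close>, which is what a de Casteljau step asks for.
\<close>

lemma bspline_eq_sum_bb_coeff:
  assumes u: "u \<in> {t j..<t (j + 1)}" and "p \<le> m"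
  shows "bspline n t p i u
       = (\<Sum>k\<le>p. bb_coeff t j p i k * Bernstein p k ((u - t j) / (t (j + 1) - t j)))"
  using \<open>p \<le> m\<close>
proof (induction p arbitrary: i)
  case 0
  have "i = j" if "0 \<le> i" "i < int n" "t i \<le> u" "u < t (i + 1)"
  proof (rule ccontr)
    assume "i \<noteq> j"
    then have "t (i + 1) \<le> t j \<or> t (j + 1) \<le> t i"
      using that j_range mono[of "i + 1" j] mono[of "j + 1" i] by linarith
    with that u show False by auto
  qed
  then have "(0 \<le> i \<and> i < int n \<and> u \<in> {t i..<t (i + 1)}) \<longleftrightarrow> i = j"
    using u j_range by (metis atLeastLessThan_iff)
  then show ?case by (simp add: Bernstein_def)
next
  case (Suc p)
  define x where "x = (u - t j) / (t (j + 1) - t j)"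
  have u_eq: "u = (1 - x) * t j + x * t (j + 1)"
    using nonempty by (simp add: x_def divide_simps) (simp add: algebra_simps)
  show ?case
  proof (cases "- int (Suc p) \<le> i \<and> i < int n")
    case False
    then have "bb_coeff t j (Suc p) i k = 0" for k
      using j_range by (intro bb_coeff_eq_0) auto
    then show ?thesis using False by auto
  next
    case True
    define A where "A l k = bb_coeff t j p l k / (t (l + int p + 1) - t l)" for l k
    have N: "bspline n t p l u / (t (l + int p + 1) - t l) = (\<Sum>k\<le>p. A l k * Bernstein p k x)" for l
      using Suc by (simp add: A_def x_def sum_divide_distrib)
    have "bspline n t (Suc p) i u
        = (u - t i) * (bspline n t p i u / (t (i + int p + 1) - t i))
        + (t (i + int p + 2) - u) * (bspline n t p (i + 1) u / (t (i + 1 + int p + 1) - t (i + 1)))"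
      using True by (simp add: Let_def algebra_simps)
    also have "\<dots> = (\<Sum>k\<le>p. ((u - t i) * A i k + (t (i + int p + 2) - u) * A (i + 1) k)
        * Bernstein p k x)"
      unfolding N sum_distrib_left sum.distrib [symmetric]
      by (rule sum.cong) (simp_all add: algebra_simps)
    also have "\<dots> = (\<Sum>k\<le>p. ((1 - x) * bb_coeff t j (Suc p) i k + x * bb_coeff t j (Suc p) i (Suc k))
        * Bernstein p k x)"
    proof (rule sum.cong)
      fix k assume k: "k \<in> {..p}"
      have L: "bb_coeff t j (Suc p) i k = (t j - t i) * A i k + (t (i + int p + 2) - t j) * A (i + 1) k"
        using bb_coeff_remove_left[of p k i] Suc.prems k by (simp add: A_def algebra_simps)
      have R: "bb_coeff t j (Suc p) i (Suc k)
          = (t (j + 1) - t i) * A i k + (t (i + int p + 2) - t (j + 1)) * A (i + 1) k"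
        by (simp add: bb_coeff.simps(3) A_def algebra_simps)
      show "((u - t i) * A i k + (t (i + int p + 2) - u) * A (i + 1) k) * Bernstein p k x
          = ((1 - x) * bb_coeff t j (Suc p) i k + x * bb_coeff t j (Suc p) i (Suc k)) * Bernstein p k x"
        unfolding L R u_eq by (simp add: algebra_simps)
    qed simp
    finally show ?thesis
      unfolding x_def[symmetric] Bernstein_Suc_sum .
  qed
qed

lemma bb_coeff_adjusted: "adjusted_BB_coeffs m n t i j (bb_coeff t j m i)"
  unfolding adjusted_BB_coeffs_def by (blast intro: bspline_eq_sum_bb_coeff)

text \<open>
  The relation within the degree \<open>m\<close>. With \<open>A l\<close> the weighted coefficient of degree \<open>m - 1\<close>, the
  coefficients \<open>k\<close> and \<open>k + 1\<close> for the index \<open>i\<close> are combinations of \<open>A i\<close> and \<open>A (i + 1)\<close>, those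
  for \<open>i + 1\<close> are combinations of \<open>A (i + 1)\<close> and \<open>A (i + 2)\<close>; eliminating \<open>A i\<close> from the former and
  \<open>A (i + 2)\<close> from the latter leaves two formulas for \<open>A (i + 1)\<close>.

  The variable \<open>z\<close> takes care of the start \<open>i = j\<close> of the sweep, where \<open>t (i + m + 2)\<close> may lie beyond
  the last knot: the coefficients for \<open>i + 1\<close> are then zero, and any value does.
\<close>

lemma bb_coeff_sweep:
  assumes i: "j - int m \<le> i" "i \<le> j" and k: "k < m"
    and z: "i < j \<Longrightarrow> z = t (i + int m + 2)"
  shows "bb_coeff t j m i k =
     ((t (i + int m + 1) - t i)
        * (((t (j + 1) - z) * bb_coeff t j m (i + 1) k + (z - t j) * bb_coeff t j m (i + 1) (Suc k))
           / (z - t (i + 1)))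
      - (t i - t j) * bb_coeff t j m i (Suc k)) / (t (j + 1) - t i)"
proof -
  obtain p where m: "m = Suc p" using k by (cases m) auto
  define A where "A l = bb_coeff t j p l k / (t (l + int p + 1) - t l)" for l
  have L: "bb_coeff t j m l k = (t j - t l) * A l + (t (l + int m + 1) - t j) * A (l + 1)" for l
    using bb_coeff_remove_left[of p k l] k by (simp add: A_def algebra_simps m)
  have R: "bb_coeff t j m l (Suc k)
      = (t (j + 1) - t l) * A l + (t (l + int m + 1) - t (j + 1)) * A (l + 1)" for l
    by (simp add: bb_coeff.simps(3) A_def algebra_simps m)
  have pos: "t i < t (j + 1)" using i j_range by (intro support_knots[of _ "j + 1"]) auto
  have eq: "(t (j + 1) - t i) * bb_coeff t j m i k + (t i - t j) * bb_coeff t j m i (Suc k)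
      = (t (i + int m + 1) - t i) * ((t (j + 1) - t j) * A (i + 1))"
    unfolding L R by (simp add: algebra_simps)
  have "((t (j + 1) - z) * bb_coeff t j m (i + 1) k + (z - t j) * bb_coeff t j m (i + 1) (Suc k))
      / (z - t (i + 1)) = (t (j + 1) - t j) * A (i + 1)"
  proof (cases "i < j")
    case True
    then have "z - t (i + 1) \<noteq> 0"
      using z support_knots[of "i + 1" "i + int m + 2"] i j_range by auto
    moreover have "(t (j + 1) - z) * bb_coeff t j m (i + 1) k + (z - t j) * bb_coeff t j m (i + 1) (Suc k)
        = (t (j + 1) - t j) * A (i + 1) * (z - t (i + 1))"
      unfolding L R using z[OF True] by (simp add: algebra_simps)
    ultimately show ?thesis by simp
  next
    case False
    then show ?thesis using i by (simp add: A_def bb_coeff_eq_0)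
  qed
  moreover have "bb_coeff t j m i k
      = ((t (i + int m + 1) - t i) * ((t (j + 1) - t j) * A (i + 1))
         - (t i - t j) * bb_coeff t j m i (Suc k)) / (t (j + 1) - t i)"
    unfolding eq [symmetric] using pos by simp
  ultimately show ?thesis by simp
qed

end


section \<open>Counting knot spans\<close>

lemma admissible_knotsD:
  assumes "admissible_knots m n t"
  shows "- int m \<le> l \<Longrightarrow> l \<le> 0 \<Longrightarrow> t l = t 0"
    and "0 \<le> l \<Longrightarrow> l < int n \<Longrightarrow> t l \<le> t (l + 1)"
    and "int n \<le> l \<Longrightarrow> l \<le> int n + int m \<Longrightarrow> t l = t (int n)"
    and "t 0 < t (int n)"
    and "1 \<le> l \<Longrightarrow> l < int n \<Longrightarrow> knot_multiplicity m n t l \<le> m"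
proof -
  note knots = assms [unfolded admissible_knots_def]
  show "- int m \<le> l \<Longrightarrow> l \<le> 0 \<Longrightarrow> t l = t 0"
    using knots [THEN conjunct1] by (meson atLeastAtMost_iff)
  show "0 \<le> l \<Longrightarrow> l < int n \<Longrightarrow> t l \<le> t (l + 1)"
    using knots [THEN conjunct2, THEN conjunct1] by simp
  show "int n \<le> l \<Longrightarrow> l \<le> int n + int m \<Longrightarrow> t l = t (int n)"
    using knots [THEN conjunct2, THEN conjunct2, THEN conjunct1] by (meson atLeastAtMost_iff)
  show "t 0 < t (int n)"
    using knots by (elim conjE)
  show "1 \<le> l \<Longrightarrow> l < int n \<Longrightarrow> knot_multiplicity m n t l \<le> m"
    using knots [THEN conjunct2, THEN conjunct2, THEN conjunct2, THEN conjunct2] by simp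
qed

lemma admissible_mono:
  assumes adm: "admissible_knots m n t"
    and kl: "- int m \<le> k" "k \<le> l" "l \<le> int n + int m"
  shows "t k \<le> t l"
  using kl(2,1,3)
proof (induction l rule: int_ge_induct)
  case base
  then show ?case by simp
next
  case (step l)
  have "t l \<le> t (l + 1)"
  proof -
    consider "l < 0" | "0 \<le> l" "l < int n" | "int n \<le> l" by linarith
    then show ?thesis
    proof cases
      case 1
      then have "t l = t 0" "t (l + 1) = t 0"
        using admissible_knotsD(1)[OF adm, of l] admissible_knotsD(1)[OF adm, of "l + 1"] step by linarith+
      then show ?thesis by simp
    next
      case 2
      then show ?thesis by (rule admissible_knotsD(2)[OF adm])
    next
      case 3
      then have "t l = t (int n)" "t (l + 1) = t (int n)"
        using admissible_knotsD(3)[OF adm, of l] admissible_knotsD(3)[OF adm, of "l + 1"] step by linarith+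
      then show ?thesis by simp
    qed
  qed
  with step show ?case by simp
qed

lemma mem_nonempty_spans: "j \<in> nonempty_spans n t \<longleftrightarrow> 0 \<le> j \<and> j < int n \<and> t j < t (j + 1)"
  by (auto simp: nonempty_spans_def)

lemma finite_nonempty_spans: "finite (nonempty_spans n t)"
  by (rule finite_subset[of _ "{0..int n - 1}"]) (auto simp: nonempty_spans_def)

lemma knot_span_nonempty_spans:
  assumes "admissible_knots m n t" "j \<in> nonempty_spans n t"
  shows "knot_span m n t j"
  using assms admissible_mono[OF assms(1)] by unfold_locales (auto simp: mem_nonempty_spans)

text \<open>
  Equal knots around an inner knot \<open>r\<close> all count towards its multiplicity.
\<close>

lemma equal_knots_bound:
  assumes adm: "admissible_knots m n t" and r: "1 \<le> r" "r < int n"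
    and l: "- int m \<le> l" "l \<le> r" "r \<le> l'" "l' \<le> int n + int m" and eq: "t l = t l'"
  shows "l' < l + int m"
proof -
  have "{l..l'} \<subseteq> {k \<in> {- int m..int n + int m}. t k = t r}"
  proof
    fix k assume k: "k \<in> {l..l'}"
    have *: "t l \<le> t x" "t x \<le> t l'" if "l \<le> x" "x \<le> l'" for x
      using admissible_mono[OF adm, of l x] admissible_mono[OF adm, of x l'] l that by auto
    show "k \<in> {k \<in> {- int m..int n + int m}. t k = t r}"
      using *[of k] *[of r] eq k l by auto
  qed
  then have "card {l..l'} \<le> knot_multiplicity m n t r"
    unfolding knot_multiplicity_def
    by (intro card_mono) (auto intro: finite_subset[of _ "{- int m..int n + int m}"])
  also have "\<dots> \<le> m"
    using r by (rule admissible_knotsD(5)[OF adm])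
  finally show ?thesis using l by simp
qed

text \<open>
  Let \<open>e\<close> be the last non-empty span up to \<open>j\<close>. The knots \<open>e + 1, \<dots>, j + 1\<close> coincide, and if
  \<open>e < j\<close> then \<open>e + 1\<close> is an inner one, so there are at most \<open>m\<close> of them. Hence the blocks
  \<open>{e..<e + m}\<close> cover all spans. The first span is non-empty because \<open>t\<^sub>0\<close> already occurs \<open>m + 1\<close>
  times.
\<close>

lemma length_le_nonempty_spans:
  assumes adm: "admissible_knots m n t" and "1 \<le> m" "1 \<le> n"
  shows "n \<le> card (nonempty_spans n t) * m"
proof -
  let ?E = "nonempty_spans n t"
  have zero: "0 \<in> ?E"
  proof (rule ccontr)
    assume "0 \<notin> ?E"
    then have "\<not> t 0 < t 1" using \<open>1 \<le> n\<close> by (simp add: mem_nonempty_spans)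
    moreover have "t 0 \<le> t 1" using admissible_mono[OF adm, of 0 1] \<open>1 \<le> n\<close> by simp
    ultimately have eq: "t 0 = t 1" by simp
    have "n \<noteq> 1" using eq admissible_knotsD(4)[OF adm] by auto
    moreover have "t (- int m) = t 1" using eq admissible_knotsD(1)[OF adm, of "- int m"] by simp
    ultimately show False
      using equal_knots_bound[OF adm, of 1 "- int m" 1] \<open>1 \<le> n\<close> by linarith
  qed
  have cover: "{0..<int n} \<subseteq> (\<Union>e\<in>?E. {e..<e + int m})"
  proof
    fix j assume j: "j \<in> {0..<int n}"
    define e where "e = Max {e \<in> ?E. e \<le> j}"
    have fin: "finite {e \<in> ?E. e \<le> j}" using finite_nonempty_spans by simp
    moreover have "{e \<in> ?E. e \<le> j} \<noteq> {}" using zero j by auto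
    ultimately have "e \<in> {e \<in> ?E. e \<le> j}" unfolding e_def by (rule Max_in)
    then have e: "e \<in> ?E" "e \<le> j" by auto
    have max: "x \<notin> ?E" if "e < x" "x \<le> j" for x
      using that Max_ge[OF fin, of x] by (auto simp: e_def)
    have const: "l \<le> j + 1 \<longrightarrow> t l = t (e + 1)" if "e + 1 \<le> l" for l
      using that
    proof (induction l rule: int_ge_induct)
      case (step l)
      show ?case
      proof
        assume l: "l + 1 \<le> j + 1"
        then have "\<not> t l < t (l + 1)" using max[of l] step e j by (auto simp: mem_nonempty_spans)
        moreover have "t l \<le> t (l + 1)"
          using admissible_mono[OF adm, of l "l + 1"] step l e j by (auto simp: mem_nonempty_spans)
        ultimately show "t (l + 1) = t (e + 1)" using step l by simp
      qed
    qed simp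
    have eq: "t (e + 1) = t (j + 1)" using const[of "j + 1"] e by simp
    have "j < e + int m"
    proof (cases "e = j")
      case True
      then show ?thesis using \<open>1 \<le> m\<close> by simp
    next
      case False
      moreover have "0 \<le> e" using e by (simp add: mem_nonempty_spans)
      ultimately have "j + 1 < (e + 1) + int m"
        using e j by (intro equal_knots_bound[OF adm _ _ _ _ _ _ eq, of "e + 1"]) auto
      then show ?thesis by simp
    qed
    with e show "j \<in> (\<Union>e\<in>?E. {e..<e + int m})" by auto
  qed
  have "n = card {0..<int n}" by simp
  also have "\<dots> \<le> card (\<Union>e\<in>?E. {e..<e + int m})"
    using cover finite_nonempty_spans by (intro card_mono) auto
  also have "\<dots> \<le> (\<Sum>e\<in>?E. card {e..<e + int m})"
    by (rule card_UN_le[OF finite_nonempty_spans])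
  also have "\<dots> = card ?E * m" by simp
  finally show ?thesis .
qed


section \<open>Timed total correctness\<close>

definition runs :: "com \<Rightarrow> state \<Rightarrow> nat \<Rightarrow> (state \<Rightarrow> bool) \<Rightarrow> bool" where
  "runs c s B Q \<longleftrightarrow> (\<exists>T s'. exec c s T s' \<and> T \<le> B \<and> Q s')"

lemma runs_mono: "runs c s A Q \<Longrightarrow> A \<le> B \<Longrightarrow> (\<And>s'. Q s' \<Longrightarrow> R s') \<Longrightarrow> runs c s B R"
  unfolding runs_def by (meson order_trans)

lemma runs_Skip: "Q s \<Longrightarrow> runs Skip s B Q"
  unfolding runs_def using exec.Skip by (metis le0)

lemma runs_RAssign:
  "rtime e \<le> B \<Longrightarrow> Q (rupdate s x (map (\<lambda>a. ival a s) is) (rval e s)) \<Longrightarrow> runs (RAssign x is e) s B Q"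
  unfolding runs_def using exec.RAssign by blast

lemma runs_Seq:
  assumes "runs c s A R" "\<And>s'. R s' \<Longrightarrow> runs d s' B Q"
  shows "runs (Seq c d) s (A + B) Q"
  using assms unfolding runs_def by (meson add_mono exec.Seq)

lemma runs_Cond:
  assumes "bval b s \<Longrightarrow> runs c s B Q" "\<not> bval b s \<Longrightarrow> runs d s B Q"
  shows "runs (Cond b c d) s (btime b + B) Q"
proof (cases "bval b s")
  case True
  then show ?thesis
    using assms(1) exec.CondTrue unfolding runs_def by (metis add_le_cancel_left)
next
  case False
  then show ?thesis
    using assms(2) exec.CondFalse unfolding runs_def by (metis add_le_cancel_left)
qed

definition For :: "vname \<Rightarrow> iexp \<Rightarrow> com \<Rightarrow> com" where
  "For x hi c = Seq (IAssign x (IConst 0))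
     (While (ILess (IVar x) hi) (Seq c (IAssign x (IAdd (IVar x) (IConst 1)))))"

text \<open>
  The invariant \<open>I k\<close> holds before the \<open>k\<close>-th pass. It has to determine the loop variable and to
  keep the bound \<open>hi\<close> constant; the control of the loop costs nothing.
\<close>

lemma runs_For:
  assumes init: "I 0 (iupdate s x 0)"
    and ctrl: "\<And>k s. I k s \<Longrightarrow> k \<le> N \<Longrightarrow> fst s x = int k \<and> ival hi s = int N"
    and step: "\<And>k s. I k s \<Longrightarrow> k < N
      \<Longrightarrow> runs c s (B k) (\<lambda>s'. fst s' x = int k \<and> I (Suc k) (iupdate s' x (int (Suc k))))"
  shows "runs (For x hi c) s (\<Sum>k<N. B k) (I N)"
proof -
  let ?W = "While (ILess (IVar x) hi) (Seq c (IAssign x (IAdd (IVar x) (IConst 1))))"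
  have loop: "runs ?W s (\<Sum>k\<in>{a..<N}. B k) (I N)" if "a \<le> N" "I a s" for a s
    using that
  proof (induction a arbitrary: s rule: inc_induct)
    case base
    then have "\<not> bval (ILess (IVar x) hi) s" using ctrl[of N s] by simp
    from exec.WhileFalse[OF this] base show ?case unfolding runs_def by fastforce
  next
    case (step a)
    then have b: "bval (ILess (IVar x) hi) s" using ctrl[of a s] by simp
    from assms(3)[OF step.prems \<open>a < N\<close>] obtain T s' where
      c: "exec c s T s'" "T \<le> B a" "fst s' x = int a" "I (Suc a) (iupdate s' x (int (Suc a)))"
      unfolding runs_def by blast
    have "exec (IAssign x (IAdd (IVar x) (IConst 1))) s' 0 (iupdate s' x (int (Suc a)))"
      using exec.IAssign[of x "IAdd (IVar x) (IConst 1)" s'] c(3) by (simp add: add.commute)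
    then have body: "exec (Seq c (IAssign x (IAdd (IVar x) (IConst 1)))) s T (iupdate s' x (int (Suc a)))"
      using exec.Seq[OF c(1)] by fastforce
    from step.IH[OF c(4)] obtain U s'' where
      w: "exec ?W (iupdate s' x (int (Suc a))) U s''" "U \<le> (\<Sum>k\<in>{Suc a..<N}. B k)" "I N s''"
      unfolding runs_def by blast
    have "exec ?W s (btime (ILess (IVar x) hi) + T + U) s''"
      by (rule exec.WhileTrue[OF b body w(1)])
    moreover have "btime (ILess (IVar x) hi) + T + U \<le> (\<Sum>k\<in>{a..<N}. B k)"
      using c(2) w(2) \<open>a < N\<close> by (simp add: sum.atLeast_Suc_lessThan)
    ultimately show ?case using w(3) unfolding runs_def by blast
  qed
  have "exec (IAssign x (IConst 0)) s 0 (iupdate s x 0)"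
    using exec.IAssign[of x "IConst 0" s] by simp
  with loop[of 0, OF _ init] show ?thesis
    unfolding For_def runs_def using exec.Seq by (fastforce simp: atLeast0LessThan)
qed


section \<open>The program\<close>

abbreviation (input) knot :: "iexp \<Rightarrow> rexp" where
  "knot a \<equiv> RRead ''t'' [a]"

abbreviation (input) ishift :: "iexp \<Rightarrow> int \<Rightarrow> iexp" where
  "ishift a c \<equiv> IAdd a (IConst c)"

text \<open>
  The programs run through the functions \<open>i = j, j - 1, \<dots>\<close> and the coefficients
  \<open>k = m - 1, m - 2, \<dots>\<close> downwards, using the upward counters \<open>d = j - i\<close> and \<open>c = m - 1 - k\<close>.
\<close>

definition idx_i :: iexp where
  "idx_i = ISub (IVar ''j'') (IVar ''d'')"

definition idx_k :: iexp where
  "idx_k = ISub (ISub (IVar ''m'') (IConst 1)) (IVar ''c'')"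

text \<open>
  The entry \<open>w[j, p, i]\<close> holds the limit of \<open>N\<^sub>p\<^sub>i\<close> at the right end of the span, which is
  \<open>bb_coeff t j p i p\<close>. Every span \<open>j\<close> has its own part of the array, so that the zeros at the
  border of the triangle are present from the start.
\<close>

definition endpoint_entry :: rexp where
  "endpoint_entry =
     (let j = IVar ''j''; p = IVar ''p''; i = idx_i in
      RAdd
        (RMul (RSub (knot (ishift j 1)) (knot i))
          (RDiv (RRead ''w'' [j, p, i]) (RSub (knot (ishift (IAdd i p) 1)) (knot i))))
        (RMul (RSub (knot (ishift (IAdd i p) 2)) (knot (ishift j 1)))
          (RDiv (RRead ''w'' [j, p, ishift i 1])
            (RSub (knot (ishift (IAdd i p) 2)) (knot (ishift i 1))))))"

definition endpoint_values :: com where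
  "endpoint_values =
     For ''p'' (IVar ''m'')
       (For ''d'' (ishift (IVar ''p'') 2)
         (RAssign ''w'' [IVar ''j'', ishift (IVar ''p'') 1, idx_i] endpoint_entry))"

text \<open>The right-hand side of \<open>bb_coeff_sweep\<close>, with \<open>z\<close> read from the array of knots.\<close>

definition sweep_entry :: rexp where
  "sweep_entry =
     (let j = IVar ''j''; m = IVar ''m''; i = idx_i; k = idx_k in
      RDiv
        (RSub
          (RMul (RSub (knot (ishift (IAdd i m) 1)) (knot i))
            (RDiv
              (RAdd
                (RMul (RSub (knot (ishift j 1)) (knot (ishift (IAdd i m) 2)))
                  (RRead ''b'' [ishift i 1, j, k]))
                (RMul (RSub (knot (ishift (IAdd i m) 2)) (knot j))
                  (RRead ''b'' [ishift i 1, j, ishift k 1])))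
              (RSub (knot (ishift (IAdd i m) 2)) (knot (ishift i 1)))))
          (RMul (RSub (knot i) (knot j)) (RRead ''b'' [i, j, ishift k 1])))
        (RSub (knot (ishift j 1)) (knot i)))"

definition sweep :: com where
  "sweep =
     For ''d'' (ishift (IVar ''m'') 1)
       (Seq (RAssign ''b'' [idx_i, IVar ''j'', IVar ''m''] (RRead ''w'' [IVar ''j'', IVar ''m'', idx_i]))
         (For ''c'' (IVar ''m'')
           (RAssign ''b'' [idx_i, IVar ''j'', idx_k] sweep_entry)))"

definition span_coeffs :: com where
  "span_coeffs =
     Seq (RAssign ''w'' [IVar ''j'', IConst 0, IVar ''j''] (RConst 1)) (Seq endpoint_values sweep)"

definition all_coeffs :: com where
  "all_coeffs =
     For ''j'' (IVar ''n'')
       (Cond (RLess (knot (IVar ''j'')) (knot (ishift (IVar ''j'') 1))) span_coeffs Skip)"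


section \<open>Correctness and running time\<close>

definition solved_spans :: "nat \<Rightarrow> nat \<Rightarrow> (int \<Rightarrow> real) \<Rightarrow> int \<Rightarrow> state \<Rightarrow> bool" where
  "solved_spans m n t j s \<longleftrightarrow>
     (\<forall>j' \<in> nonempty_spans n t. j' < j \<longrightarrow>
        (\<forall>i \<in> {j' - int m..j'}. \<forall>k\<le>m. snd s ''b'' [i, j', int k] = bb_coeff t j' m i k))"

definition fresh_spans :: "int \<Rightarrow> state \<Rightarrow> bool" where
  "fresh_spans j s \<longleftrightarrow> (\<forall>j'\<ge>j. \<forall>p i k. snd s ''w'' [j', p, i] = 0 \<and> snd s ''b'' [i, j', k] = 0)"

definition has_input :: "nat \<Rightarrow> nat \<Rightarrow> (int \<Rightarrow> real) \<Rightarrow> int \<Rightarrow> state \<Rightarrow> bool" where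
  "has_input m n t j s \<longleftrightarrow>
     fst s ''m'' = int m \<and> fst s ''n'' = int n \<and> fst s ''j'' = j \<and>
     (\<forall>l \<in> {- int m..int n + int m}. snd s ''t'' [l] = t l)"

text \<open>The part of the state that work on the span \<open>j\<close> leaves intact.\<close>

definition in_span :: "nat \<Rightarrow> nat \<Rightarrow> (int \<Rightarrow> real) \<Rightarrow> int \<Rightarrow> state \<Rightarrow> bool" where
  "in_span m n t j s \<longleftrightarrow> has_input m n t j s \<and> solved_spans m n t j s \<and> fresh_spans (j + 1) s"

lemma in_span_iupdate:
  "in_span m n t j s \<Longrightarrow> x \<notin> {''m'', ''n'', ''j''} \<Longrightarrow> in_span m n t j (iupdate s x v)"
  by (auto simp: in_span_def has_input_def solved_spans_def fresh_spans_def iupdate_def)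

lemma in_span_write_w:
  "in_span m n t j s \<Longrightarrow> in_span m n t j (rupdate s ''w'' [j, p, i] v)"
  by (auto simp: in_span_def has_input_def solved_spans_def fresh_spans_def rupdate_def)

lemma in_span_write_b:
  "in_span m n t j s \<Longrightarrow> in_span m n t j (rupdate s ''b'' [i, j, k] v)"
  by (auto simp: in_span_def has_input_def solved_spans_def fresh_spans_def rupdate_def)

lemma fst_iupdate [simp]: "fst (iupdate s x v) y = (if y = x then v else fst s y)"
  and snd_iupdate [simp]: "snd (iupdate s x v) = snd s"
  by (auto simp: iupdate_def)

lemma fst_rupdate [simp]: "fst (rupdate s x is v) = fst s"
  and snd_rupdate [simp]:
    "snd (rupdate s x is v) y js = (if y = x \<and> js = is then v else snd s y js)"
  by (auto simp: rupdate_def)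

context knot_span
begin

lemma in_span_vars:
  assumes "in_span m n t j s"
  shows "fst s ''m'' = int m" "fst s ''j'' = j"
    and "\<And>l. - int m \<le> l \<Longrightarrow> l \<le> int n + int m \<Longrightarrow> snd s ''t'' [l] = t l"
  using assms by (auto simp: in_span_def has_input_def)

definition empty_b :: "state \<Rightarrow> bool" where
  "empty_b s \<longleftrightarrow> (\<forall>i k. snd s ''b'' [i, j, k] = 0)"

text \<open>
  Row \<open>p + 1\<close> is filled for \<open>i = j, \<dots>, j - p - 1\<close>. Both the entries left of this range and those
  right of it agree with \<open>bb_coeff\<close> since that is zero there, hence the invariants can speak of
  all \<open>i\<close>. One entry takes nine operations.
\<close>

lemma endpoint_values_correct:
  assumes s: "in_span m n t j s" "empty_b s"
    and w: "\<And>p i. snd s ''w'' [j, p, i] = (if p = 0 \<and> i = j then 1 else 0)"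
  shows "runs endpoint_values s (9 * m * (m + 1))
    (\<lambda>s. in_span m n t j s \<and> empty_b s \<and> (\<forall>i. snd s ''w'' [j, int m, i] = bb_coeff t j m i m))"
proof -
  define Row where "Row p s \<longleftrightarrow> in_span m n t j s \<and> empty_b s \<and> fst s ''p'' = int p
      \<and> (\<forall>i. snd s ''w'' [j, int p, i] = bb_coeff t j p i p)
      \<and> (\<forall>q>p. \<forall>i. snd s ''w'' [j, int q, i] = 0)" for p s
  define Entries where "Entries p d s \<longleftrightarrow> in_span m n t j s \<and> empty_b s
      \<and> fst s ''p'' = int p \<and> fst s ''d'' = int d
      \<and> (\<forall>i. snd s ''w'' [j, int p, i] = bb_coeff t j p i p)
      \<and> (\<forall>i. snd s ''w'' [j, int p + 1, i] = (if j - int d < i then bb_coeff t j (Suc p) i (Suc p) else 0))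
      \<and> (\<forall>q>Suc p. \<forall>i. snd s ''w'' [j, int q, i] = 0)"
    for p d s
  have row: "runs (For ''d'' (ishift (IVar ''p'') 2)
         (RAssign ''w'' [IVar ''j'', ishift (IVar ''p'') 1, idx_i] endpoint_entry)) s (9 * (m + 1))
         (\<lambda>s'. fst s' ''p'' = int p \<and> Row (Suc p) (iupdate s' ''p'' (int (Suc p))))"
    if p: "p < m" and s: "Row p s" for p s
  proof (rule runs_mono[OF runs_For[where I = "Entries p" and B = "\<lambda>_. 9" and N = "p + 2"]])
    have "snd s ''w'' [j, int (Suc p), i] = 0" for i
      using s unfolding Row_def by blast
    then show "Entries p 0 (iupdate s ''d'' 0)"
      using s by (auto simp: Entries_def Row_def in_span_iupdate empty_b_def bb_coeff_eq_0 add.commute)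
  next
    fix d s
    assume s: "Entries p d s" and d: "d < p + 2"
    let ?i = "j - int d"
    from s have sp: "in_span m n t j s" and vars: "fst s ''p'' = int p" "fst s ''d'' = int d"
      and w: "\<And>i. snd s ''w'' [j, int p, i] = bb_coeff t j p i p"
      by (auto simp: Entries_def)
    note vars = vars in_span_vars[OF sp]
    have val: "rval endpoint_entry s = bb_coeff t j (Suc p) ?i (Suc p)"
      using p d j_range
      by (simp add: endpoint_entry_def Let_def idx_i_def vars w bb_coeff.simps(3))
    show "runs (RAssign ''w'' [IVar ''j'', ishift (IVar ''p'') 1, idx_i] endpoint_entry) s 9
        (\<lambda>s'. fst s' ''d'' = int d \<and> Entries p (Suc d) (iupdate s' ''d'' (int (Suc d))))"
    proof (rule runs_RAssign)
      show "rtime endpoint_entry \<le> 9" by (simp add: endpoint_entry_def Let_def)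
    next
      let ?s' = "rupdate s ''w'' [j, int p + 1, ?i] (bb_coeff t j (Suc p) ?i (Suc p))"
      have "Entries p (Suc d) (iupdate ?s' ''d'' (int (Suc d)))"
        using s by (auto simp: Entries_def empty_b_def intro!: in_span_iupdate in_span_write_w)
      then show "fst (rupdate s ''w'' (map (\<lambda>a. ival a s) [IVar ''j'', ishift (IVar ''p'') 1, idx_i])
            (rval endpoint_entry s)) ''d'' = int d
        \<and> Entries p (Suc d) (iupdate (rupdate s ''w''
            (map (\<lambda>a. ival a s) [IVar ''j'', ishift (IVar ''p'') 1, idx_i]) (rval endpoint_entry s))
            ''d'' (int (Suc d)))"
        by (simp add: val vars idx_i_def)
    qed
  next
    show "(\<Sum>d<p + 2. 9) \<le> 9 * (m + 1)" using p by simp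
  next
    fix s assume s: "Entries p (p + 2) s"
    have "snd s ''w'' [j, int p + 1, i] = bb_coeff t j (Suc p) i (Suc p)" for i
      using s by (auto simp: Entries_def bb_coeff_eq_0)
    then show "fst s ''p'' = int p \<and> Row (Suc p) (iupdate s ''p'' (int (Suc p)))"
      using s by (auto simp: Entries_def Row_def empty_b_def add.commute intro!: in_span_iupdate)
  qed (auto simp: Entries_def)
  show ?thesis
    unfolding endpoint_values_def
  proof (rule runs_mono[OF runs_For[where I = Row and B = "\<lambda>_. 9 * (m + 1)" and N = m]])
    show "Row 0 (iupdate s ''p'' 0)"
      using s w by (auto simp: Row_def in_span_iupdate empty_b_def)
  next
    fix p s assume "Row p s"
    then show "fst s ''p'' = int p \<and> ival (IVar ''m'') s = int m"
      by (auto simp: Row_def in_span_vars)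
  next
    show "(\<Sum>p<m. 9 * (m + 1)) \<le> 9 * m * (m + 1)" by (simp add: algebra_simps)
  qed (use row in \<open>auto simp: Row_def\<close>)
qed

text \<open>
  The sweep can begin with the formula for \<open>i = j\<close>, because the entries for \<open>i > j\<close>, being zero, are
  correct initially. One entry takes fourteen operations.
\<close>

lemma sweep_correct:
  assumes s: "in_span m n t j s" "empty_b s"
    and w: "\<And>i. snd s ''w'' [j, int m, i] = bb_coeff t j m i m"
  shows "runs sweep s (14 * m * (m + 1))
    (\<lambda>s. in_span m n t j s \<and> (\<forall>i\<ge>j - int m. \<forall>k\<le>m. snd s ''b'' [i, j, int k] = bb_coeff t j m i k))"
proof -
  define Cols where "Cols d s \<longleftrightarrow> in_span m n t j s \<and> fst s ''d'' = int d
      \<and> (\<forall>i. snd s ''w'' [j, int m, i] = bb_coeff t j m i m)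
      \<and> (\<forall>i>j - int d. \<forall>k\<le>m. snd s ''b'' [i, j, int k] = bb_coeff t j m i k)" for d s
  define Entries where "Entries d c s \<longleftrightarrow> Cols d s \<and> fst s ''c'' = int c
      \<and> (\<forall>k\<le>m. m - c \<le> k \<longrightarrow> snd s ''b'' [j - int d, j, int k] = bb_coeff t j m (j - int d) k)" for d c s
  have col: "runs (Seq (RAssign ''b'' [idx_i, IVar ''j'', IVar ''m'']
            (RRead ''w'' [IVar ''j'', IVar ''m'', idx_i]))
         (For ''c'' (IVar ''m'')
           (RAssign ''b'' [idx_i, IVar ''j'', idx_k] sweep_entry))) s (0 + (\<Sum>c<m. 14))
         (\<lambda>s'. fst s' ''d'' = int d \<and> Cols (Suc d) (iupdate s' ''d'' (int (Suc d))))"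
    if d: "d < m + 1" and s: "Cols d s" for d s
  proof (rule runs_Seq)
    let ?i = "j - int d"
    from s have sp: "in_span m n t j s" and vars: "fst s ''d'' = int d"
      and w: "\<And>i. snd s ''w'' [j, int m, i] = bb_coeff t j m i m"
      by (auto simp: Cols_def)
    note vars = vars in_span_vars[OF sp]
    have "Cols d (rupdate s ''b'' [?i, j, int m] (bb_coeff t j m ?i m))"
      using s by (auto simp: Cols_def intro!: in_span_write_b)
    then show "runs (RAssign ''b'' [idx_i, IVar ''j'', IVar ''m'']
            (RRead ''w'' [IVar ''j'', IVar ''m'', idx_i])) s 0
        (\<lambda>s. Cols d s \<and> snd s ''b'' [?i, j, int m] = bb_coeff t j m ?i m)"
      by (intro runs_RAssign) (simp_all add: vars w idx_i_def)
  next
    let ?i = "j - int d"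
    fix s assume s: "Cols d s \<and> snd s ''b'' [?i, j, int m] = bb_coeff t j m ?i m"
    show "runs (For ''c'' (IVar ''m'') (RAssign ''b'' [idx_i, IVar ''j'', idx_k] sweep_entry)) s (\<Sum>c<m. 14)
        (\<lambda>s'. fst s' ''d'' = int d \<and> Cols (Suc d) (iupdate s' ''d'' (int (Suc d))))"
    proof (rule runs_mono[OF runs_For[where I = "Entries d" and B = "\<lambda>_. 14" and N = m] order_refl])
      show "Entries d 0 (iupdate s ''c'' 0)"
        using s by (auto simp: Entries_def Cols_def intro!: in_span_iupdate)
    next
      fix c s assume "Entries d c s"
      then show "fst s ''c'' = int c \<and> ival (IVar ''m'') s = int m"
        by (auto simp: Entries_def Cols_def in_span_vars)
    next
      fix c s assume s: "Entries d c s" and c: "c < m"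
      define k where "k = m - Suc c"
      have k: "int m - 1 - int c = int k" "k < m" "m - c = Suc k"
        using c by (auto simp: k_def)
      from s have sp: "in_span m n t j s" and vars: "fst s ''d'' = int d" "fst s ''c'' = int c"
        and right: "\<And>k. k \<le> m \<Longrightarrow> snd s ''b'' [?i + 1, j, int k] = bb_coeff t j m (?i + 1) k"
        by (auto simp: Entries_def Cols_def)
      have above: "snd s ''b'' [?i, j, int (Suc k)] = bb_coeff t j m ?i (Suc k)"
        using s k unfolding Entries_def by (metis Suc_leI order_refl)
      note vars = vars in_span_vars[OF sp]
      have z: "snd s ''t'' [?i + int m + 2] = t (?i + int m + 2)" if "?i < j"
        using that d j_range by (intro vars) auto
      have kn: "snd s ''t'' [?i] = t ?i" "snd s ''t'' [?i + 1] = t (?i + 1)"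
        "snd s ''t'' [?i + int m + 1] = t (?i + int m + 1)"
        "snd s ''t'' [j] = t j" "snd s ''t'' [j + 1] = t (j + 1)"
        using d j_range by (auto intro!: vars)
      have right1: "snd s ''b'' [?i + 1, j, int k + 1] = bb_coeff t j m (?i + 1) (Suc k)"
        and above1: "snd s ''b'' [?i, j, int k + 1] = bb_coeff t j m ?i (Suc k)"
        using right[of "Suc k"] above k(2) by (simp_all add: add.commute)
      have idx: "ival idx_i s = ?i" "ival idx_k s = int k"
        using k by (simp_all add: idx_i_def idx_k_def vars)
      have val: "rval sweep_entry s = bb_coeff t j m ?i k"
        using bb_coeff_sweep[OF _ _ k(2) z] d right[of k] right1 above1 k(2)
        by (simp add: sweep_entry_def Let_def idx vars(3,4) kn)
      show "runs (RAssign ''b'' [idx_i, IVar ''j'', idx_k] sweep_entry) s 14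
        (\<lambda>s'. fst s' ''c'' = int c \<and> Entries d (Suc c) (iupdate s' ''c'' (int (Suc c))))"
      proof (rule runs_RAssign)
        show "rtime sweep_entry \<le> 14" by (simp add: sweep_entry_def Let_def)
      next
        let ?s' = "rupdate s ''b'' [?i, j, int k] (bb_coeff t j m ?i k)"
        have "Cols d ?s'"
          using s by (auto simp: Entries_def Cols_def intro!: in_span_write_b)
        then have "Cols d (iupdate ?s' ''c'' (int (Suc c)))"
          by (auto simp: Cols_def intro!: in_span_iupdate)
        moreover have "snd ?s' ''b'' [?i, j, int l] = bb_coeff t j m ?i l" if "l \<le> m" "m - Suc c \<le> l" for l
          using s that k by (cases "l = k") (auto simp: Entries_def)
        ultimately have "Entries d (Suc c) (iupdate ?s' ''c'' (int (Suc c)))"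
          by (simp add: Entries_def)
        then show "fst (rupdate s ''b'' (map (\<lambda>a. ival a s) [idx_i, IVar ''j'', idx_k])
              (rval sweep_entry s)) ''c'' = int c
          \<and> Entries d (Suc c) (iupdate (rupdate s ''b''
              (map (\<lambda>a. ival a s) [idx_i, IVar ''j'', idx_k]) (rval sweep_entry s))
              ''c'' (int (Suc c)))"
          by (simp add: val vars idx)
      qed
    next
      fix s assume s: "Entries d m s"
      have "snd s ''b'' [i, j, int k] = bb_coeff t j m i k" if "j - int (Suc d) < i" "k \<le> m" for i k
        using s that by (cases "i = ?i") (auto simp: Entries_def Cols_def)
      then show "fst s ''d'' = int d \<and> Cols (Suc d) (iupdate s ''d'' (int (Suc d)))"
        using s by (auto simp: Entries_def Cols_def intro!: in_span_iupdate)
    qed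
  qed
  show ?thesis
    unfolding sweep_def
  proof (rule runs_mono[OF runs_For[where I = Cols and B = "\<lambda>_. 0 + (\<Sum>c<m. 14)" and N = "m + 1"]])
    show "Cols 0 (iupdate s ''d'' 0)"
      using s w by (auto simp: Cols_def empty_b_def bb_coeff_eq_0 intro!: in_span_iupdate)
  next
    fix d s assume "Cols d s"
    then show "fst s ''d'' = int d \<and> ival (ishift (IVar ''m'') 1) s = int (m + 1)"
      by (auto simp: Cols_def in_span_vars)
  next
    fix d s assume "Cols d s" "d < m + 1"
    then show "runs (Seq (RAssign ''b'' [idx_i, IVar ''j'', IVar ''m'']
            (RRead ''w'' [IVar ''j'', IVar ''m'', idx_i]))
         (For ''c'' (IVar ''m'')
           (RAssign ''b'' [idx_i, IVar ''j'', idx_k] sweep_entry))) s (0 + (\<Sum>c<m. 14))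
         (\<lambda>s'. fst s' ''d'' = int d \<and> Cols (Suc d) (iupdate s' ''d'' (int (Suc d))))"
      by (intro col)
  qed (auto simp: Cols_def)
qed

lemma span_coeffs_correct:
  assumes s: "has_input m n t j s" "solved_spans m n t j s" "fresh_spans j s"
  shows "runs span_coeffs s (23 * m * (m + 1))
    (\<lambda>s. has_input m n t j s \<and> solved_spans m n t (j + 1) s \<and> fresh_spans (j + 1) s)"
proof -
  let ?s = "rupdate s ''w'' [j, 0, j] 1"
  have sp: "in_span m n t j s" using s by (auto simp: in_span_def fresh_spans_def)
  have "runs span_coeffs s (0 + (9 * m * (m + 1) + 14 * m * (m + 1)))
      (\<lambda>s. in_span m n t j s \<and> (\<forall>i\<ge>j - int m. \<forall>k\<le>m. snd s ''b'' [i, j, int k] = bb_coeff t j m i k))"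
    unfolding span_coeffs_def
  proof (intro runs_Seq)
    show "runs (RAssign ''w'' [IVar ''j'', IConst 0, IVar ''j''] (RConst 1)) s 0 (\<lambda>s'. s' = ?s)"
      by (intro runs_RAssign) (simp_all add: in_span_vars[OF sp])
  next
    fix s' assume "s' = ?s"
    then show "runs endpoint_values s' (9 * m * (m + 1)) (\<lambda>s. in_span m n t j s \<and> empty_b s
        \<and> (\<forall>i. snd s ''w'' [j, int m, i] = bb_coeff t j m i m))"
      using s sp by (intro endpoint_values_correct)
        (auto simp: in_span_write_w empty_b_def fresh_spans_def)
  next
    fix s' assume "in_span m n t j s' \<and> empty_b s' \<and> (\<forall>i. snd s' ''w'' [j, int m, i] = bb_coeff t j m i m)"
    then show "runs sweep s' (14 * m * (m + 1))
        (\<lambda>s. in_span m n t j s \<and> (\<forall>i\<ge>j - int m. \<forall>k\<le>m. snd s ''b'' [i, j, int k] = bb_coeff t j m i k))"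
      by (intro sweep_correct) simp_all
  qed
  then show ?thesis
  proof (rule runs_mono)
    fix s assume "in_span m n t j s \<and> (\<forall>i\<ge>j - int m. \<forall>k\<le>m. snd s ''b'' [i, j, int k] = bb_coeff t j m i k)"
    then show "has_input m n t j s \<and> solved_spans m n t (j + 1) s \<and> fresh_spans (j + 1) s"
      by (auto simp: in_span_def solved_spans_def zless_add1_eq)
  qed (simp add: algebra_simps)
qed

end

lemma all_coeffs_correct:
  assumes adm: "admissible_knots m n t"
  shows "runs all_coeffs (input_state m n t)
      (n + card (nonempty_spans n t) * (23 * m * (m + 1))) (solved_spans m n t (int n))"
proof -
  let ?E = "nonempty_spans n t" and ?B = "23 * m * (m + 1)"
  define I where "I j s \<longleftrightarrow> has_input m n t (int j) s \<and> solved_spans m n t (int j) s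
      \<and> fresh_spans (int j) s" for j s
  have step: "runs (Cond (RLess (knot (IVar ''j'')) (knot (ishift (IVar ''j'') 1))) span_coeffs Skip) s
      (1 + (if int j \<in> ?E then ?B else 0))
      (\<lambda>s'. fst s' ''j'' = int j \<and> I (Suc j) (iupdate s' ''j'' (int (Suc j))))"
    if s: "I j s" and j: "j < n" for j s
  proof -
    have next_span: "I (Suc j) (iupdate s' ''j'' (int (Suc j)))" "fst s' ''j'' = int j"
      if "has_input m n t (int j) s' \<and> solved_spans m n t (int j + 1) s' \<and> fresh_spans (int j + 1) s'"
      for s'
      using that by (auto simp: I_def has_input_def solved_spans_def fresh_spans_def add.commute)
    have t: "bval (RLess (knot (IVar ''j'')) (knot (ishift (IVar ''j'') 1))) s
        \<longleftrightarrow> int j \<in> ?E"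
      using s j by (auto simp: I_def has_input_def mem_nonempty_spans)
    have "runs (Cond (RLess (knot (IVar ''j'')) (knot (ishift (IVar ''j'') 1))) span_coeffs Skip) s
        (btime (RLess (knot (IVar ''j'')) (knot (ishift (IVar ''j'') 1)))
          + (if int j \<in> ?E then ?B else 0))
        (\<lambda>s'. has_input m n t (int j) s' \<and> solved_spans m n t (int j + 1) s' \<and> fresh_spans (int j + 1) s')"
      unfolding t
    proof (rule runs_Cond; unfold t)
      assume E: "int j \<in> ?E"
      with s knot_span.span_coeffs_correct[OF knot_span_nonempty_spans[OF adm E]]
      show "runs span_coeffs s (if int j \<in> ?E then ?B else 0)
        (\<lambda>s'. has_input m n t (int j) s' \<and> solved_spans m n t (int j + 1) s' \<and> fresh_spans (int j + 1) s')"
        by (simp add: I_def)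
    next
      assume "int j \<notin> ?E"
      with s have "has_input m n t (int j) s \<and> solved_spans m n t (int j + 1) s \<and> fresh_spans (int j + 1) s"
        by (auto simp: I_def solved_spans_def fresh_spans_def zless_add1_eq)
      then show "runs Skip s (if int j \<in> ?E then ?B else 0)
        (\<lambda>s'. has_input m n t (int j) s' \<and> solved_spans m n t (int j + 1) s' \<and> fresh_spans (int j + 1) s')"
        by (rule runs_Skip)
    qed
    then show ?thesis
      by (rule runs_mono) (use next_span in auto)
  qed
  \<comment> \<open>The loop counts in natural numbers, whereas spans are integers.\<close>
  have E: "?E = int ` {j. j < n \<and> int j \<in> ?E}"
  proof (intro equalityI subsetI)
    fix j assume "j \<in> ?E"
    then show "j \<in> int ` {j. j < n \<and> int j \<in> ?E}"
      by (intro image_eqI[of _ _ "nat j"]) (auto simp: mem_nonempty_spans)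
  qed auto
  have "card {j. j < n \<and> int j \<in> ?E} = card ?E"
    by (subst (2) E) (simp add: card_image)
  moreover have "{..<n} \<inter> {j. int j \<in> ?E} = {j. j < n \<and> int j \<in> ?E}" by auto
  ultimately have bound: "(\<Sum>j<n. 1 + (if int j \<in> ?E then ?B else 0)) = n + card ?E * ?B"
    unfolding sum.distrib by (simp add: sum.If_cases)
  show ?thesis
    unfolding all_coeffs_def
  proof (rule runs_mono[OF runs_For[where I = I and N = n
          and B = "\<lambda>j. 1 + (if int j \<in> ?E then ?B else 0)"]])
    show "I 0 (iupdate (input_state m n t) ''j'' 0)"
      by (auto simp: I_def has_input_def solved_spans_def fresh_spans_def input_state_def
          mem_nonempty_spans)
  next
    fix j s assume "I j s"
    then show "fst s ''j'' = int j \<and> ival (IVar ''n'') s = int n"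
      by (simp add: I_def has_input_def)
  qed (use step bound in \<open>auto simp: I_def\<close>)
qed

theorem mainTheorem4:
  shows "\<exists>(P :: com) (C :: real). \<forall>(m :: nat) (n :: nat) (t :: int \<Rightarrow> real).
    m \<ge> 1 \<longrightarrow> n \<ge> 1 \<longrightarrow> admissible_knots m n t \<longrightarrow>
    (\<exists>T s. exec P (input_state m n t) T s \<and>
       real T \<le> C * real (card (nonempty_spans n t)) * real m ^ 2 \<and>
       (\<forall>j \<in> nonempty_spans n t. \<forall>i \<in> {j - int m..j}.
          adjusted_BB_coeffs m n t i j (output_coeff s i j)))"
  \<comment> \<open>Per non-empty span, \<open>23 m (m + 1) \<le> 46 m\<^sup>2\<close> operations and at most \<open>m \<le> m\<^sup>2\<close> comparisons.\<close>
proof (rule exI[of _ all_coeffs], rule exI[of _ 47], intro allI impI)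
  fix m n :: nat and t :: "int \<Rightarrow> real"
  assume m: "1 \<le> m" and n: "1 \<le> n" and adm: "admissible_knots m n t"
  let ?E = "nonempty_spans n t"
  from all_coeffs_correct[OF adm] obtain T s where
    exec: "exec all_coeffs (input_state m n t) T s"
    and T: "T \<le> n + card ?E * (23 * m * (m + 1))"
    and s: "solved_spans m n t (int n) s"
    unfolding runs_def by blast
  have "n \<le> card ?E * m" by (rule length_le_nonempty_spans[OF adm m n])
  also have "\<dots> \<le> card ?E * m\<^sup>2" using m by (simp add: power2_eq_square)
  finally have "n \<le> card ?E * m\<^sup>2" .
  moreover have "23 * m * (m + 1) \<le> 46 * m\<^sup>2" using m by (simp add: power2_eq_square)
  then have "card ?E * (23 * m * (m + 1)) \<le> card ?E * (46 * m\<^sup>2)" by (rule mult_le_mono2)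
  ultimately have "T \<le> 47 * (card ?E * m\<^sup>2)" using T by linarith
  then have "real T \<le> real (47 * (card ?E * m\<^sup>2))" by (rule of_nat_mono)
  then have time: "real T \<le> 47 * real (card ?E) * real m ^ 2" by simp
  have "adjusted_BB_coeffs m n t i j (output_coeff s i j)" if "j \<in> ?E" "i \<in> {j - int m..j}" for i j
  proof -
    have "output_coeff s i j k = bb_coeff t j m i k" if "k \<le> m" for k
      using s that \<open>j \<in> ?E\<close> \<open>i \<in> {j - int m..j}\<close>
      by (auto simp: solved_spans_def output_coeff_def mem_nonempty_spans)
    with knot_span.bb_coeff_adjusted[OF knot_span_nonempty_spans[OF adm \<open>j \<in> ?E\<close>], of i]
    show ?thesis by (simp add: adjusted_BB_coeffs_def)
  qed
  with exec time show "\<exists>T s. exec all_coeffs (input_state m n t) T s \<and>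
       real T \<le> 47 * real (card ?E) * real m ^ 2 \<and>
       (\<forall>j \<in> ?E. \<forall>i \<in> {j - int m..j}. adjusted_BB_coeffs m n t i j (output_coeff s i j))"
    by blast
qed

end
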